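(* Let $(\Omega,\mathcal F,P)$ be a probability space and let $f:L^{0}(\mathcal F,\mathbb R)\to L^{0}(\mathcal F,\mathbb R)$ be a local function which is continuous when $L^{0}(\mathcal F,\mathbb R)$ is endowed with the topology of convergence in probability $P$. Let $Y_1,Y_2\in L^{0}(\mathcal F,\mathbb R)$ be such that $Y_1\le Y_2$. Then for any $\xi\in[f(Y_1)\wedge f(Y_2),\,f(Y_1)\vee f(Y_2)]$ there exists $\eta\in[Y_1,Y_2]$ such that $f(\eta)=\xi$.
   Context: $L^{0}(\mathcal F,\mathbb R)$ is the algebra of equivalence classes (modulo $P$-almost sure equality) of real-valued random variables on $(\Omega,\mathcal F,P)$. It is ordered by $\xi\le\eta$ iff $\xi^0(\omega)\le\eta^0(\omega)$ for $P$-almost all $\omega$, where $\xi^0,\eta^0$ are representatives of $\xi,\eta$; $\wedge$ and $\vee$ denote infimum and supremum in this lattice. For $\alpha_1\le\alpha_2$ in $L^{0}(\mathcal F,\mathbb R)$, $[\alpha_1,\alpha_2]=\{\alpha\in L^{0}(\mathcal F,\mathbb R):\alpha_1\le\alpha\le\alpha_2\}$. A function $f:L^{0}(\mathcal F,\mathbb R)\to L^{0}(\mathcal F,\mathbb R)$ is called local if $\tilde I_A f(x)=\tilde I_A f(\tilde I_A x)$ for every $A\in\mathcal F$ and $x\in L^{0}(\mathcal F,\mathbb R)$, where $\tilde I_A$ is the equivalence class of the characteristic function of $A$. *)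

theory Defs
  imports "HOL-Algebra.Lattice" "HOL-Probability.Probability"
begin

definition ae_rel :: "'a measure \<Rightarrow> (('a \<Rightarrow> real) \<times> ('a \<Rightarrow> real)) set" where
  "ae_rel M = {(X, Y). X \<in> borel_measurable M \<and> Y \<in> borel_measurable M \<and> (AE \<omega> in M. X \<omega> = Y \<omega>)}"

definition L0 :: "'a measure \<Rightarrow> ('a \<Rightarrow> real) set set" where
  "L0 M = borel_measurable M // ae_rel M"

definition L0_class :: "'a measure \<Rightarrow> ('a \<Rightarrow> real) \<Rightarrow> ('a \<Rightarrow> real) set" where
  "L0_class M X = ae_rel M `` {X}"

text \<open>On \<^term>\<open>L0 M\<close> the choice of representatives in the definitions of
  product, order and neighbourhoods below is irrelevant; the union over representatives is a union of copies of one and the same class.\<close>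

definition L0_mult ::
  "'a measure \<Rightarrow> ('a \<Rightarrow> real) set \<Rightarrow> ('a \<Rightarrow> real) set \<Rightarrow> ('a \<Rightarrow> real) set" where
  "L0_mult M x y = (\<Union>X\<in>x. \<Union>Y\<in>y. L0_class M (\<lambda>\<omega>. X \<omega> * Y \<omega>))"

definition L0_le :: "'a measure \<Rightarrow> ('a \<Rightarrow> real) set \<Rightarrow> ('a \<Rightarrow> real) set \<Rightarrow> bool" where
  "L0_le M x y \<longleftrightarrow> (\<exists>X\<in>x. \<exists>Y\<in>y. AE \<omega> in M. X \<omega> \<le> Y \<omega>)"

text \<open>The meet, join and order interval of this structure are those of HOL-Algebra.\<close>

definition L0_order :: "'a measure \<Rightarrow> ('a \<Rightarrow> real) set gorder" where
  "L0_order M = \<lparr>carrier = L0 M, eq = (=), le = L0_le M\<rparr>"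

text \<open>The topology of convergence in probability: the neighbourhoods of \<open>x\<close> are generated by the
  sets of all \<open>y\<close> with \<open>P(|x - y| < \<epsilon>) > 1 - \<delta>\<close>, for \<open>\<epsilon>, \<delta> > 0\<close>.\<close>

definition L0_nbhd ::
  "'a measure \<Rightarrow> ('a \<Rightarrow> real) set \<Rightarrow> real \<Rightarrow> real \<Rightarrow> ('a \<Rightarrow> real) set set" where
  "L0_nbhd M x \<epsilon> \<delta> =
    {y \<in> L0 M. \<exists>X\<in>x. \<exists>Y\<in>y. measure M {\<omega> \<in> space M. \<bar>X \<omega> - Y \<omega>\<bar> < \<epsilon>} > 1 - \<delta>}"

definition L0_topology :: "'a measure \<Rightarrow> ('a \<Rightarrow> real) set topology" where
  "L0_topology M = topology (\<lambda>U. U \<subseteq> L0 M \<and> (\<forall>x\<in>U. \<exists>\<epsilon>>0. \<exists>\<delta>>0. L0_nbhd M x \<epsilon> \<delta> \<subseteq> U))"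

definition L0_local :: "'a measure \<Rightarrow> (('a \<Rightarrow> real) set \<Rightarrow> ('a \<Rightarrow> real) set) \<Rightarrow> bool" where
  "L0_local M f \<longleftrightarrow>
    (\<forall>A\<in>sets M. \<forall>x\<in>L0 M.
      L0_mult M (L0_class M (indicator A)) (f x) =
      L0_mult M (L0_class M (indicator A)) (f (L0_mult M (L0_class M (indicator A)) x)))"

lemma equiv_ae_rel: "equiv (borel_measurable M) (ae_rel M)"
proof (rule equivI)
  show "trans (ae_rel M)"
  proof (rule transI)
    fix X Y Z assume "(X, Y) \<in> ae_rel M" "(Y, Z) \<in> ae_rel M"
    then show "(X, Z) \<in> ae_rel M" unfolding ae_rel_def by auto
  qed
  show "sym (ae_rel M)"
    unfolding ae_rel_def by (rule symI) (auto elim: AE_mp)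
qed (auto simp: ae_rel_def refl_on_def)

lemma L0_class_in_L0: "X \<in> borel_measurable M \<Longrightarrow> L0_class M X \<in> L0 M"
  by (simp add: L0_def L0_class_def quotientI)

lemma mem_L0_class:
  "Y \<in> L0_class M X \<longleftrightarrow>
    X \<in> borel_measurable M \<and> Y \<in> borel_measurable M \<and> (AE \<omega> in M. X \<omega> = Y \<omega>)"
  by (simp add: L0_class_def ae_rel_def)

lemma L0E:
  assumes "x \<in> L0 M"
  obtains X where "X \<in> borel_measurable M" "x = L0_class M X"
  using assms unfolding L0_def L0_class_def by (auto elim: quotientE)

lemma L0_class_eq_iff:
  assumes "X \<in> borel_measurable M" "Y \<in> borel_measurable M"
  shows "L0_class M X = L0_class M Y \<longleftrightarrow> (AE \<omega> in M. X \<omega> = Y \<omega>)"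
  using eq_equiv_class_iff[OF equiv_ae_rel[of M] assms] assms
  unfolding L0_class_def by (simp add: ae_rel_def)

lemma L0_mult_class:
  assumes [measurable]: "X \<in> borel_measurable M" "Y \<in> borel_measurable M"
  shows "L0_mult M (L0_class M X) (L0_class M Y) = L0_class M (\<lambda>\<omega>. X \<omega> * Y \<omega>)"
proof -
  have "L0_class M (\<lambda>\<omega>. X' \<omega> * Y' \<omega>) = L0_class M (\<lambda>\<omega>. X \<omega> * Y \<omega>)"
    if "X' \<in> L0_class M X" "Y' \<in> L0_class M Y" for X' Y'
  proof -
    have [measurable]: "X' \<in> borel_measurable M" "Y' \<in> borel_measurable M"
      and ae: "AE \<omega> in M. X \<omega> = X' \<omega>" "AE \<omega> in M. Y \<omega> = Y' \<omega>"
      using that by (auto simp: mem_L0_class)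
    have "AE \<omega> in M. X' \<omega> * Y' \<omega> = X \<omega> * Y \<omega>"
      using ae by eventually_elim simp
    then show ?thesis by (subst L0_class_eq_iff) auto
  qed
  moreover have "X \<in> L0_class M X" "Y \<in> L0_class M Y"
    using assms by (simp_all add: mem_L0_class)
  ultimately show ?thesis unfolding L0_mult_def by blast
qed

lemma L0_le_class:
  assumes "X \<in> borel_measurable M" "Y \<in> borel_measurable M"
  shows "L0_le M (L0_class M X) (L0_class M Y) \<longleftrightarrow> (AE \<omega> in M. X \<omega> \<le> Y \<omega>)"
proof
  assume "L0_le M (L0_class M X) (L0_class M Y)"
  then obtain X' Y' where ae: "AE \<omega> in M. X \<omega> = X' \<omega>" "AE \<omega> in M. Y \<omega> = Y' \<omega>"
    "AE \<omega> in M. X' \<omega> \<le> Y' \<omega>"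
    unfolding L0_le_def by (auto simp: mem_L0_class)
  from ae show "AE \<omega> in M. X \<omega> \<le> Y \<omega>" by eventually_elim simp
next
  assume "AE \<omega> in M. X \<omega> \<le> Y \<omega>"
  then show "L0_le M (L0_class M X) (L0_class M Y)"
    unfolding L0_le_def using assms
    by (intro bexI[of _ X] bexI[of _ Y]) (simp_all add: mem_L0_class)
qed

lemma partial_order_L0: "partial_order (L0_order M)"
proof (rule partial_order.intro)
  show "weak_partial_order (L0_order M)"
  proof (unfold_locales, goal_cases)
    case (4 x)
    then show ?case by (auto simp: L0_order_def L0_le_class elim!: L0E)
  next
    case (5 x y)
    then obtain X Y where m: "X \<in> borel_measurable M" "Y \<in> borel_measurable M"
      "x = L0_class M X" "y = L0_class M Y"
      by (auto simp: L0_order_def elim!: L0E)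
    with 5 have "AE \<omega> in M. X \<omega> \<le> Y \<omega>" "AE \<omega> in M. Y \<omega> \<le> X \<omega>"
      by (simp_all add: L0_order_def L0_le_class)
    then have "AE \<omega> in M. X \<omega> = Y \<omega>" by eventually_elim simp
    then show ?case using m by (simp add: L0_order_def L0_class_eq_iff)
  next
    case (6 x y z)
    then obtain X Y Z where m: "X \<in> borel_measurable M" "Y \<in> borel_measurable M"
      "Z \<in> borel_measurable M" "x = L0_class M X" "y = L0_class M Y" "z = L0_class M Z"
      by (auto simp: L0_order_def elim!: L0E)
    with 6 have "AE \<omega> in M. X \<omega> \<le> Y \<omega>" "AE \<omega> in M. Y \<omega> \<le> Z \<omega>"
      by (simp_all add: L0_order_def L0_le_class)
    then have "AE \<omega> in M. X \<omega> \<le> Z \<omega>" by eventually_elim simp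
    then show ?case using m by (simp add: L0_order_def L0_le_class)
  qed (simp_all add: L0_order_def)
qed (simp add: partial_order_axioms_def L0_order_def)

lemma least_Upper_L0:
  assumes [measurable]: "X \<in> borel_measurable M" "Y \<in> borel_measurable M"
  shows "least (L0_order M) (L0_class M (\<lambda>\<omega>. max (X \<omega>) (Y \<omega>)))
    (Upper (L0_order M) {L0_class M X, L0_class M Y})"
proof -
  have "L0_le M (L0_class M (\<lambda>\<omega>. max (X \<omega>) (Y \<omega>))) u"
    if u: "u \<in> L0 M" "L0_le M (L0_class M X) u" "L0_le M (L0_class M Y) u" for u
  proof -
    from u(1) obtain U where U[measurable]: "U \<in> borel_measurable M" and eq: "u = L0_class M U"
      by (rule L0E)
    have "AE \<omega> in M. X \<omega> \<le> U \<omega>" "AE \<omega> in M. Y \<omega> \<le> U \<omega>"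
      using u(2,3) by (simp_all add: eq L0_le_class)
    then have "AE \<omega> in M. max (X \<omega>) (Y \<omega>) \<le> U \<omega>" by eventually_elim simp
    then show ?thesis by (simp add: eq L0_le_class)
  qed
  then show ?thesis
    by (auto simp: least_def Upper_def L0_order_def L0_le_class L0_class_in_L0)
qed

lemma greatest_Lower_L0:
  assumes [measurable]: "X \<in> borel_measurable M" "Y \<in> borel_measurable M"
  shows "greatest (L0_order M) (L0_class M (\<lambda>\<omega>. min (X \<omega>) (Y \<omega>)))
    (Lower (L0_order M) {L0_class M X, L0_class M Y})"
proof -
  have "L0_le M u (L0_class M (\<lambda>\<omega>. min (X \<omega>) (Y \<omega>)))"
    if u: "u \<in> L0 M" "L0_le M u (L0_class M X)" "L0_le M u (L0_class M Y)" for u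
  proof -
    from u(1) obtain U where U[measurable]: "U \<in> borel_measurable M" and eq: "u = L0_class M U"
      by (rule L0E)
    have "AE \<omega> in M. U \<omega> \<le> X \<omega>" "AE \<omega> in M. U \<omega> \<le> Y \<omega>"
      using u(2,3) by (simp_all add: eq L0_le_class)
    then have "AE \<omega> in M. U \<omega> \<le> min (X \<omega>) (Y \<omega>)" by eventually_elim simp
    then show ?thesis by (simp add: eq L0_le_class)
  qed
  then show ?thesis
    by (auto simp: greatest_def Lower_def L0_order_def L0_le_class L0_class_in_L0)
qed

lemma lattice_L0: "lattice (L0_order M)"
proof -
  interpret partial_order "L0_order M" by (rule partial_order_L0)
  show ?thesis
  proof (unfold_locales, goal_cases)
    case (1 x y)
    then obtain X Y where "X \<in> borel_measurable M" "Y \<in> borel_measurable M"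
      "x = L0_class M X" "y = L0_class M Y"
      by (auto simp: L0_order_def elim!: L0E)
    then show ?case using least_Upper_L0 by blast
  next
    case (2 x y)
    then obtain X Y where "X \<in> borel_measurable M" "Y \<in> borel_measurable M"
      "x = L0_class M X" "y = L0_class M Y"
      by (auto simp: L0_order_def elim!: L0E)
    then show ?case using greatest_Lower_L0 by blast
  qed
qed

lemma L0_nbhd_class:
  assumes X[measurable]: "X \<in> borel_measurable M" and Y[measurable]: "Y \<in> borel_measurable M"
  shows "L0_class M Y \<in> L0_nbhd M (L0_class M X) \<epsilon> \<delta> \<longleftrightarrow>
    measure M {\<omega> \<in> space M. \<bar>X \<omega> - Y \<omega>\<bar> < \<epsilon>} > 1 - \<delta>"
proof -
  have *: "measure M {\<omega> \<in> space M. \<bar>X' \<omega> - Y' \<omega>\<bar> < \<epsilon>} =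
      measure M {\<omega> \<in> space M. \<bar>X \<omega> - Y \<omega>\<bar> < \<epsilon>}"
    if "X' \<in> L0_class M X" "Y' \<in> L0_class M Y" for X' Y'
  proof (rule measure_eq_AE)
    have [measurable]: "X' \<in> borel_measurable M" "Y' \<in> borel_measurable M"
      and ae: "AE \<omega> in M. X \<omega> = X' \<omega>" "AE \<omega> in M. Y \<omega> = Y' \<omega>"
      using that by (auto simp: mem_L0_class)
    from ae show "AE \<omega> in M. (\<omega> \<in> {\<omega> \<in> space M. \<bar>X' \<omega> - Y' \<omega>\<bar> < \<epsilon>}) =
        (\<omega> \<in> {\<omega> \<in> space M. \<bar>X \<omega> - Y \<omega>\<bar> < \<epsilon>})"
      by eventually_elim simp
    show "{\<omega> \<in> space M. \<bar>X' \<omega> - Y' \<omega>\<bar> < \<epsilon>} \<in> sets M"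
      "{\<omega> \<in> space M. \<bar>X \<omega> - Y \<omega>\<bar> < \<epsilon>} \<in> sets M"
      by measurable
  qed
  have "X \<in> L0_class M X" "Y \<in> L0_class M Y"
    using X Y by (simp_all add: mem_L0_class)
  with * have "(\<exists>X'\<in>L0_class M X. \<exists>Y'\<in>L0_class M Y.
      measure M {\<omega> \<in> space M. \<bar>X' \<omega> - Y' \<omega>\<bar> < \<epsilon>} > 1 - \<delta>) \<longleftrightarrow>
    measure M {\<omega> \<in> space M. \<bar>X \<omega> - Y \<omega>\<bar> < \<epsilon>} > 1 - \<delta>"
    by (metis (lifting))
  then show ?thesis
    unfolding L0_nbhd_def using L0_class_in_L0[OF Y] by simp
qed

lemma L0_nbhd_mono:
  assumes "prob_space M" "x \<in> L0 M" "\<epsilon> \<le> \<epsilon>'" "\<delta> \<le> \<delta>'"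
  shows "L0_nbhd M x \<epsilon> \<delta> \<subseteq> L0_nbhd M x \<epsilon>' \<delta>'"
proof
  interpret prob_space M by fact
  fix y assume y: "y \<in> L0_nbhd M x \<epsilon> \<delta>"
  then have "y \<in> L0 M" by (simp add: L0_nbhd_def)
  with assms(2) obtain X Y where [measurable]: "X \<in> borel_measurable M" "Y \<in> borel_measurable M"
    and eq: "x = L0_class M X" "y = L0_class M Y"
    by (auto elim!: L0E)
  have "measure M {\<omega> \<in> space M. \<bar>X \<omega> - Y \<omega>\<bar> < \<epsilon>} \<le> measure M {\<omega> \<in> space M. \<bar>X \<omega> - Y \<omega>\<bar> < \<epsilon>'}"
    using assms(3) by (intro finite_measure_mono) auto
  then show "y \<in> L0_nbhd M x \<epsilon>' \<delta>'"
    using y assms(4) by (simp add: eq L0_nbhd_class)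
qed

lemma openin_L0_topology:
  assumes "prob_space M"
  shows "openin (L0_topology M) U \<longleftrightarrow>
    U \<subseteq> L0 M \<and> (\<forall>x\<in>U. \<exists>\<epsilon>>0. \<exists>\<delta>>0. L0_nbhd M x \<epsilon> \<delta> \<subseteq> U)"
proof -
  let ?O = "\<lambda>U. U \<subseteq> L0 M \<and> (\<forall>x\<in>U. \<exists>\<epsilon>>0. \<exists>\<delta>>0. L0_nbhd M x \<epsilon> \<delta> \<subseteq> U)"
  have inter: "?O (S \<inter> T)" if S: "?O S" and T: "?O T" for S T
  proof (intro conjI ballI)
    fix x assume x: "x \<in> S \<inter> T"
    then have L: "x \<in> L0 M" using S by blast
    from x obtain a b where a: "a > 0" "b > 0" "L0_nbhd M x a b \<subseteq> S"
      using S[THEN conjunct2, THEN bspec, of x] by auto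
    from x obtain c d where c: "c > 0" "d > 0" "L0_nbhd M x c d \<subseteq> T"
      using T[THEN conjunct2, THEN bspec, of x] by auto
    have "L0_nbhd M x (min a c) (min b d) \<subseteq> L0_nbhd M x a b"
      "L0_nbhd M x (min a c) (min b d) \<subseteq> L0_nbhd M x c d"
      by (intro L0_nbhd_mono[OF assms L]; simp)+
    then have "L0_nbhd M x (min a c) (min b d) \<subseteq> S \<inter> T" using a c by blast
    moreover have "min a c > 0" "min b d > 0" using a c by auto
    ultimately show "\<exists>\<epsilon>>0. \<exists>\<delta>>0. L0_nbhd M x \<epsilon> \<delta> \<subseteq> S \<inter> T" by blast
  qed (use S in \<open>simp add: le_infI1\<close>)
  have union: "?O (\<Union>\<K>)" if K: "\<forall>U\<in>\<K>. ?O U" for \<K>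
  proof (intro conjI ballI)
    fix x assume "x \<in> \<Union>\<K>"
    then obtain U where U: "U \<in> \<K>" "x \<in> U" by blast
    with K obtain a b where "a > 0" "b > 0" "L0_nbhd M x a b \<subseteq> U" by blast
    with U show "\<exists>\<epsilon>>0. \<exists>\<delta>>0. L0_nbhd M x \<epsilon> \<delta> \<subseteq> \<Union>\<K>" by blast
  qed (use K in \<open>simp add: Union_least\<close>)
  have "istopology ?O"
    unfolding istopology_def
  proof (rule conjI)
    show "\<forall>S T. ?O S \<longrightarrow> ?O T \<longrightarrow> ?O (S \<inter> T)"
      by (intro allI impI) (rule inter)
    show "\<forall>\<K>. (\<forall>K\<in>\<K>. ?O K) \<longrightarrow> ?O (\<Union>\<K>)"
      by (intro allI impI) (rule union)
  qed
  then have "openin (L0_topology M) = ?O"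
    unfolding L0_topology_def by (rule topology_inverse')
  then show ?thesis by (rule fun_cong)
qed

lemma topspace_L0_topology:
  assumes "prob_space M"
  shows "topspace (L0_topology M) = L0 M"
proof
  show "topspace (L0_topology M) \<subseteq> L0 M"
    using openin_L0_topology[OF assms, THEN iffD1, OF openin_topspace] by (rule conjunct1)
  have "openin (L0_topology M) (L0 M)"
  proof (rule openin_L0_topology[OF assms, THEN iffD2], intro conjI ballI exI)
    show "L0_nbhd M x 1 1 \<subseteq> L0 M" for x
      unfolding L0_nbhd_def by (rule Collect_restrict)
  qed simp_all
  then show "L0 M \<subseteq> topspace (L0_topology M)" by (rule openin_subset)
qed

end

theory Submission
  imports Defs
begin

text \<open>
  The idea is to run the classical bisection simultaneously at every \<open>\<omega>\<close>.  Pick representatives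
  of \<open>Y\<^sub>1 \<le> Y\<^sub>2\<close> and a representative \<open>F X\<close> of the value of \<open>f\<close> at the class of \<open>X\<close>; let \<open>Z\<close> represent
  \<open>\<xi>\<close>.  Let \<open>S\<close> be \<open>1\<close> where \<open>F Y\<^sub>1 \<le> F Y\<^sub>2\<close> and \<open>-1\<close> elsewhere, so that the hypothesis on \<open>\<xi>\<close> becomes
  the single sign condition \<open>S (F Y\<^sub>1 - Z) \<le> 0 \<le> S (F Y\<^sub>2 - Z)\<close>.  Given a bracket \<open>a \<le> b\<close> with midpoint
  \<open>m\<close>, replace \<open>a\<close> by \<open>m\<close> on the event \<open>S (F m - Z) \<le> 0\<close>, and \<open>b\<close> by \<open>m\<close> on its complement.

  The value of \<open>f\<close> is not determined pointwise, so it is not obvious that the sign condition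
  survives when an end point is pasted together from two random variables.  This is exactly what locality
  gives: on an event where two arguments agree, the values agree
  (\<open>L0_local_cong\<close>, \<open>L0_local_AE_piecewise\<close>).

  The brackets shrink by the factor 2 at each \<open>\<omega>\<close>, so both end points converge pointwise, hence
  in probability, to one random variable \<open>\<eta>\<close> between \<open>Y\<^sub>1\<close> and \<open>Y\<^sub>2\<close>.  The sign conditions define closed
  sets (\<open>closedin_L0_sign\<close>), and preimages of closed sets under the continuous map \<open>f\<close> are closed, so both
  conditions pass to the limit: \<open>S (F \<eta> - Z)\<close> vanishes almost surely, that is, \<open>f \<eta> = \<xi>\<close>.
\<close>

section \<open>Equivalence classes of random variables\<close>

lemma L0_class_cong_AE:
  assumes "X \<in> borel_measurable M" "Y \<in> borel_measurable M" "AE \<omega> in M. X \<omega> = Y \<omega>"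
  shows "L0_class M X = L0_class M Y"
  using assms by (simp add: L0_class_eq_iff)

lemma meet_L0:
  assumes "X \<in> borel_measurable M" "Y \<in> borel_measurable M"
  shows "L0_class M X \<sqinter>\<^bsub>L0_order M\<^esub> L0_class M Y = L0_class M (\<lambda>\<omega>. min (X \<omega>) (Y \<omega>))"
proof -
  interpret partial_order "L0_order M" by (rule partial_order_L0)
  show ?thesis
    unfolding Lattice.meet_def Lattice.inf_def
    using greatest_Lower_L0[OF assms] greatest_unique by (intro some_equality) auto
qed

lemma join_L0:
  assumes "X \<in> borel_measurable M" "Y \<in> borel_measurable M"
  shows "L0_class M X \<squnion>\<^bsub>L0_order M\<^esub> L0_class M Y = L0_class M (\<lambda>\<omega>. max (X \<omega>) (Y \<omega>))"
proof -
  interpret partial_order "L0_order M" by (rule partial_order_L0)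
  show ?thesis
    unfolding Lattice.join_def Lattice.sup_def
    using least_Upper_L0[OF assms] least_unique by (intro some_equality) auto
qed

section \<open>Local functions\<close>

text \<open>Both values are compared with the value at the common product of the arguments with the
  indicator of \<open>A\<close>.\<close>

lemma L0_local_cong:
  assumes loc: "L0_local M f" and A[measurable]: "A \<in> sets M"
    and X[measurable]: "X \<in> borel_measurable M" "X' \<in> borel_measurable M"
    and V[measurable]: "V \<in> borel_measurable M" "V' \<in> borel_measurable M"
    and f: "f (L0_class M X) = L0_class M V" "f (L0_class M X') = L0_class M V'"
    and eq: "\<And>\<omega>. \<omega> \<in> A \<Longrightarrow> X \<omega> = X' \<omega>"
  shows "AE \<omega> in M. \<omega> \<in> A \<longrightarrow> V \<omega> = V' \<omega>"
proof -
  let ?I = "indicator A :: 'a \<Rightarrow> real"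
  have I[measurable]: "?I \<in> borel_measurable M" by simp
  have prod: "(\<lambda>\<omega>. ?I \<omega> * X \<omega>) = (\<lambda>\<omega>. ?I \<omega> * X' \<omega>)"
    using eq by (auto simp: indicator_def)
  have "L0_mult M (L0_class M ?I) (f (L0_class M X)) = L0_mult M (L0_class M ?I) (f (L0_class M X'))"
    using loc[unfolded L0_local_def, rule_format, OF A L0_class_in_L0[OF X(1)]]
      loc[unfolded L0_local_def, rule_format, OF A L0_class_in_L0[OF X(2)]]
    by (simp only: L0_mult_class[OF I X(1)] L0_mult_class[OF I X(2)] prod)
  then have "L0_class M (\<lambda>\<omega>. ?I \<omega> * V \<omega>) = L0_class M (\<lambda>\<omega>. ?I \<omega> * V' \<omega>)"
    by (simp add: f L0_mult_class)
  then have "AE \<omega> in M. ?I \<omega> * V \<omega> = ?I \<omega> * V' \<omega>"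
    by (subst (asm) L0_class_eq_iff) auto
  then show ?thesis by eventually_elim (auto simp: indicator_def)
qed

text \<open>This is the form of locality that bisection uses: a condition on the values of \<open>f\<close> that holds
  for one argument on an event and for another argument off it survives pasting the two arguments.\<close>

lemma L0_local_AE_piecewise:
  assumes loc: "L0_local M f"
    and F: "\<And>X. X \<in> borel_measurable M \<Longrightarrow> F X \<in> borel_measurable M"
      "\<And>X. X \<in> borel_measurable M \<Longrightarrow> f (L0_class M X) = L0_class M (F X)"
    and X[measurable]: "X \<in> borel_measurable M" "X' \<in> borel_measurable M"
    and G[measurable]: "Measurable.pred M G"
    and P: "AE \<omega> in M. G \<omega> \<longrightarrow> P \<omega> (F X \<omega>)" "AE \<omega> in M. \<not> G \<omega> \<longrightarrow> P \<omega> (F X' \<omega>)"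
  shows "AE \<omega> in M. P \<omega> (F (\<lambda>\<omega>. if G \<omega> then X \<omega> else X' \<omega>) \<omega>)"
proof -
  let ?W = "\<lambda>\<omega>. if G \<omega> then X \<omega> else X' \<omega>"
  have W[measurable]: "?W \<in> borel_measurable M" by measurable
  have "AE \<omega> in M. \<omega> \<in> {\<omega> \<in> space M. G \<omega>} \<longrightarrow> F ?W \<omega> = F X \<omega>"
    by (rule L0_local_cong[OF loc _ W X(1) F(1)[OF W] F(1)[OF X(1)] F(2)[OF W] F(2)[OF X(1)]])
      auto
  moreover have "AE \<omega> in M. \<omega> \<in> {\<omega> \<in> space M. \<not> G \<omega>} \<longrightarrow> F ?W \<omega> = F X' \<omega>"
    by (rule L0_local_cong[OF loc _ W X(2) F(1)[OF W] F(1)[OF X(2)] F(2)[OF W] F(2)[OF X(2)]])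
      auto
  ultimately show ?thesis
    using P AE_space by eventually_elim (auto split: if_splits)
qed

section \<open>Closed sets for convergence in probability\<close>

lemma eventually_L0_nbhd:
  assumes "prob_space M"
    and X[measurable]: "\<And>n. X n \<in> borel_measurable M" "Y \<in> borel_measurable M"
    and lim: "AE \<omega> in M. (\<lambda>n. X n \<omega>) \<longlonglongrightarrow> Y \<omega>" and pos: "\<epsilon> > 0" "\<delta> > 0"
  shows "\<forall>\<^sub>F n in sequentially. L0_class M (X n) \<in> L0_nbhd M (L0_class M Y) \<epsilon> \<delta>"
proof -
  interpret prob_space M by fact
  let ?A = "\<lambda>n. {\<omega> \<in> space M. \<bar>Y \<omega> - X n \<omega>\<bar> < \<epsilon>}"
  have "(\<lambda>n. \<integral>\<omega>. indicator (?A n) \<omega> \<partial>M) \<longlonglongrightarrow> (\<integral>\<omega>. 1 \<partial>M :: real)"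
  proof (rule integral_dominated_convergence[where w = "\<lambda>_. 1"])
    show "AE \<omega> in M. (\<lambda>n. indicator (?A n) \<omega> :: real) \<longlonglongrightarrow> 1"
      using lim AE_space
    proof eventually_elim
      case (elim \<omega>)
      have "\<forall>\<^sub>F n in sequentially. dist (X n \<omega>) (Y \<omega>) < \<epsilon>"
        using elim(1) pos(1) by (rule tendstoD)
      then have "\<forall>\<^sub>F n in sequentially. indicator (?A n) \<omega> = (1 :: real)"
        by eventually_elim (use elim(2) in \<open>auto simp: dist_real_def\<close>)
      then show ?case by (rule tendsto_eventually)
    qed
  qed auto
  then have "(\<lambda>n. measure M (?A n)) \<longlonglongrightarrow> 1" by (simp add: prob_space)
  then have "\<forall>\<^sub>F n in sequentially. measure M (?A n) > 1 - \<delta>"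
    by (rule order_tendstoD(1)) (use pos in simp)
  then show ?thesis by (simp add: L0_nbhd_class)
qed

lemma closedin_L0_AE_limit:
  assumes "prob_space M" "closedin (L0_topology M) C"
    and X: "\<And>n. X n \<in> borel_measurable M" "Y \<in> borel_measurable M"
    and lim: "AE \<omega> in M. (\<lambda>n. X n \<omega>) \<longlonglongrightarrow> Y \<omega>" and C: "\<And>n. L0_class M (X n) \<in> C"
  shows "L0_class M Y \<in> C"
proof (rule ccontr)
  assume "L0_class M Y \<notin> C"
  then have "L0_class M Y \<in> L0 M - C" using X by (simp add: L0_class_in_L0)
  moreover have "openin (L0_topology M) (L0 M - C)"
    using assms(1,2) by (simp add: closedin_def topspace_L0_topology)
  ultimately obtain \<epsilon> \<delta> where "\<epsilon> > 0" "\<delta> > 0" "L0_nbhd M (L0_class M Y) \<epsilon> \<delta> \<subseteq> L0 M - C"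
    unfolding openin_L0_topology[OF assms(1)] by meson
  moreover from this(1,2) have "\<exists>n. L0_class M (X n) \<in> L0_nbhd M (L0_class M Y) \<epsilon> \<delta>"
    using eventually_L0_nbhd[OF assms(1) X lim] by (metis eventually_happens sequentially_bot)
  ultimately show False using C by blast
qed

text \<open>If the inequality fails for \<open>Y\<close>, it fails by more than some \<open>t > 0\<close> on an event of positive
  probability.  Any \<open>Y'\<close> that is \<open>t\<close>-close to \<open>Y\<close> outside a smaller event violates it as well.\<close>

lemma closedin_L0_sign:
  assumes "prob_space M"
    and [measurable]: "S \<in> borel_measurable M" "Z \<in> borel_measurable M"
    and S: "\<And>\<omega>. \<bar>S \<omega>\<bar> \<le> (1::real)"
  shows "closedin (L0_topology M)
    {L0_class M Y |Y. Y \<in> borel_measurable M \<and> (AE \<omega> in M. S \<omega> * (Y \<omega> - Z \<omega>) \<le> 0)}"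
    (is "closedin _ ?C")
proof -
  interpret prob_space M by fact
  have inC: "L0_class M Y \<in> ?C \<longleftrightarrow> (AE \<omega> in M. S \<omega> * (Y \<omega> - Z \<omega>) \<le> 0)"
    if Y: "Y \<in> borel_measurable M" for Y
  proof
    assume "L0_class M Y \<in> ?C"
    then obtain Y' where "Y' \<in> borel_measurable M" "L0_class M Y = L0_class M Y'"
      and le: "AE \<omega> in M. S \<omega> * (Y' \<omega> - Z \<omega>) \<le> 0" by blast
    with Y have "AE \<omega> in M. Y \<omega> = Y' \<omega>" by (simp add: L0_class_eq_iff)
    with le show "AE \<omega> in M. S \<omega> * (Y \<omega> - Z \<omega>) \<le> 0" by eventually_elim simp
  qed (use Y in blast)
  have "\<exists>\<epsilon>>0. \<exists>\<delta>>0. L0_nbhd M y \<epsilon> \<delta> \<subseteq> L0 M - ?C" if y: "y \<in> L0 M - ?C" for y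
  proof -
    from y obtain Y where Y[measurable]: "Y \<in> borel_measurable M" and yY: "y = L0_class M Y"
      by (blast elim: L0E)
    let ?B = "\<lambda>n. {\<omega> \<in> space M. S \<omega> * (Y \<omega> - Z \<omega>) > 1 / real (Suc n)}"
    have "\<exists>n. prob (?B n) > 0"
    proof (rule ccontr)
      assume "\<nexists>n. prob (?B n) > 0"
      then have "prob (?B n) = 0" for n
        using measure_nonneg[of M "?B n"] by (simp add: not_less order_antisym)
      then have "AE \<omega> in M. \<not> (S \<omega> * (Y \<omega> - Z \<omega>) > 1 / real (Suc n))" for n
        by (subst (asm) prob_eq_0) auto
      then have "AE \<omega> in M. \<forall>n. \<not> (S \<omega> * (Y \<omega> - Z \<omega>) > 1 / real (Suc n))"
        unfolding AE_all_countable by blast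
      then have "AE \<omega> in M. S \<omega> * (Y \<omega> - Z \<omega>) \<le> 0"
        by eventually_elim (meson nat_approx_posE not_le)
      with y show False by (simp add: yY inC)
    qed
    then obtain n where n: "prob (?B n) > 0" ..
    define t where "t = 1 / real (Suc n)"
    have "L0_nbhd M y t (prob (?B n)) \<subseteq> L0 M - ?C"
    proof
      fix y' assume y': "y' \<in> L0_nbhd M y t (prob (?B n))"
      then have "y' \<in> L0 M" by (simp add: L0_nbhd_def)
      then obtain Y' where Y'[measurable]: "Y' \<in> borel_measurable M" and yY': "y' = L0_class M Y'"
        by (rule L0E)
      let ?A = "{\<omega> \<in> space M. \<bar>Y \<omega> - Y' \<omega>\<bar> < t}"
      have A: "prob ?A > 1 - prob (?B n)"
        using y' by (simp add: yY yY' L0_nbhd_class)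
      have False if "AE \<omega> in M. S \<omega> * (Y' \<omega> - Z \<omega>) \<le> 0"
      proof -
        have "AE \<omega> in M. \<omega> \<in> ?A \<longrightarrow> \<omega> \<notin> ?B n"
          using that
        proof eventually_elim
          case (elim \<omega>)
          show ?case
          proof (intro impI notI)
            assume "\<omega> \<in> ?A" "\<omega> \<in> ?B n"
            then have "\<bar>Y \<omega> - Y' \<omega>\<bar> < t" "S \<omega> * (Y \<omega> - Z \<omega>) > t" by (auto simp: t_def)
            moreover have "S \<omega> * (Y \<omega> - Y' \<omega>) \<le> \<bar>S \<omega>\<bar> * \<bar>Y \<omega> - Y' \<omega>\<bar>"
              by (metis abs_ge_self abs_mult)
            moreover have "\<bar>S \<omega>\<bar> * \<bar>Y \<omega> - Y' \<omega>\<bar> \<le> \<bar>Y \<omega> - Y' \<omega>\<bar>"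
              using S[of \<omega>] by (simp add: mult_left_le_one_le)
            ultimately show False using elim by (simp add: algebra_simps)
          qed
        qed
        then have "prob ?A \<le> prob (space M - ?B n)"
          by (intro finite_measure_mono_AE) auto
        also have "\<dots> = 1 - prob (?B n)" by (rule prob_compl) simp
        finally show False using A by simp
      qed
      then show "y' \<in> L0 M - ?C" using \<open>y' \<in> L0 M\<close> inC[OF Y'] unfolding yY' by blast
    qed
    moreover have "t > 0" by (simp add: t_def)
    ultimately show ?thesis using n by blast
  qed
  then have "openin (L0_topology M) (L0 M - ?C)"
    unfolding openin_L0_topology[OF assms(1)] by blast
  then show ?thesis
    unfolding closedin_def topspace_L0_topology[OF assms(1)] by (auto simp: L0_class_in_L0)
qed

text \<open>Continuity of \<open>f\<close> enters only here, through closedness of the preimage of a closed set.\<close>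

lemma L0_AE_sign_limit:
  assumes "prob_space M" "continuous_map (L0_topology M) (L0_topology M) f"
    and F: "\<And>X. X \<in> borel_measurable M \<Longrightarrow> F X \<in> borel_measurable M"
      "\<And>X. X \<in> borel_measurable M \<Longrightarrow> f (L0_class M X) = L0_class M (F X)"
    and S: "S \<in> borel_measurable M" "Z \<in> borel_measurable M" "\<And>\<omega>. \<bar>S \<omega>\<bar> \<le> (1::real)"
    and X: "\<And>n. X n \<in> borel_measurable M" "Y \<in> borel_measurable M"
    and lim: "AE \<omega> in M. (\<lambda>n. X n \<omega>) \<longlonglongrightarrow> Y \<omega>"
    and le: "\<And>n. AE \<omega> in M. S \<omega> * (F (X n) \<omega> - Z \<omega>) \<le> 0"
  shows "AE \<omega> in M. S \<omega> * (F Y \<omega> - Z \<omega>) \<le> 0"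
proof -
  let ?C = "{L0_class M Y |Y. Y \<in> borel_measurable M \<and> (AE \<omega> in M. S \<omega> * (Y \<omega> - Z \<omega>) \<le> 0)}"
  have "closedin (L0_topology M) {x \<in> topspace (L0_topology M). f x \<in> ?C}"
    using assms(2) closedin_L0_sign[OF assms(1) S] by (rule closedin_continuous_map_preimage)
  then have "L0_class M Y \<in> {x \<in> topspace (L0_topology M). f x \<in> ?C}"
    by (rule closedin_L0_AE_limit[OF assms(1) _ X lim])
      (use F X le in \<open>auto simp: topspace_L0_topology[OF assms(1)] L0_class_in_L0\<close>)
  then obtain V where "V \<in> borel_measurable M" "L0_class M (F Y) = L0_class M V"
    and V: "AE \<omega> in M. S \<omega> * (V \<omega> - Z \<omega>) \<le> 0"
    using F(2)[OF X(2)] by auto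
  then have "AE \<omega> in M. F Y \<omega> = V \<omega>" using F(1)[OF X(2)] by (simp add: L0_class_eq_iff)
  with V show ?thesis by eventually_elim simp
qed

section \<open>Pointwise bisection\<close>

text \<open>\<open>G m \<omega>\<close> says that, at \<open>\<omega>\<close>, the value at \<open>m\<close> lies below the target.  It takes the whole
  random variable \<open>m\<close> and not just the number \<open>m \<omega>\<close>, because only classes have values.\<close>

fun bisect :: "(('a \<Rightarrow> real) \<Rightarrow> 'a \<Rightarrow> bool) \<Rightarrow> ('a \<Rightarrow> real) \<times> ('a \<Rightarrow> real) \<Rightarrow> ('a \<Rightarrow> real) \<times> ('a \<Rightarrow> real)"
  where "bisect G (a, b) = (let m = (\<lambda>\<omega>. (a \<omega> + b \<omega>) / 2) in
    (\<lambda>\<omega>. if G m \<omega> then m \<omega> else a \<omega>, \<lambda>\<omega>. if G m \<omega> then b \<omega> else m \<omega>))"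

lemma bisect_limit:
  fixes G :: "('a \<Rightarrow> real) \<Rightarrow> 'a \<Rightarrow> bool"
  defines "p \<equiv> \<lambda>a b n. (bisect G ^^ n) (a, b)"
  assumes le: "a \<omega> \<le> b \<omega>"
  shows "\<exists>l. a \<omega> \<le> l \<and> l \<le> b \<omega> \<and> (\<lambda>n. fst (p a b n) \<omega>) \<longlonglongrightarrow> l \<and> (\<lambda>n. snd (p a b n) \<omega>) \<longlonglongrightarrow> l"
proof -
  define u where "u n = fst (p a b n) \<omega>" for n
  define v where "v n = snd (p a b n) \<omega>" for n
  have uv0: "u 0 = a \<omega>" "v 0 = b \<omega>" by (simp_all add: u_def v_def p_def)
  have step: "(u (Suc n) = (u n + v n) / 2 \<and> v (Suc n) = v n)
      \<or> (u (Suc n) = u n \<and> v (Suc n) = (u n + v n) / 2)" for n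
    by (cases "p a b n") (auto simp: u_def v_def p_def Let_def)
  have diff: "u n - v n = (a \<omega> - b \<omega>) * (1 / 2) ^ n" for n
  proof (induction n)
    case (Suc n)
    have "u (Suc n) - v (Suc n) = (u n - v n) * (1 / 2)"
      using step[of n] by (auto simp: field_simps)
    with Suc show ?case by simp
  qed (simp add: uv0)
  have uv: "u n \<le> v n" for n
    using diff[of n] le mult_nonpos_nonneg[of "a \<omega> - b \<omega>" "(1 / 2) ^ n"] by simp
  have mono: "u n \<le> u (Suc n) \<and> v (Suc n) \<le> v n" for n
    using step[of n] uv[of n] by auto
  have "\<exists>l. ((\<forall>n. u n \<le> l) \<and> u \<longlonglongrightarrow> l) \<and> ((\<forall>n. l \<le> v n) \<and> v \<longlonglongrightarrow> l)"
  proof (rule nested_sequence_unique)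
    show "\<forall>n. u n \<le> u (Suc n)" "\<forall>n. v (Suc n) \<le> v n"
      using mono by auto
    show "(\<lambda>n. u n - v n) \<longlonglongrightarrow> 0"
      unfolding diff by (intro tendsto_mult_right_zero LIMSEQ_power_zero) simp
  qed (use uv in blast)
  then show ?thesis using uv0 unfolding u_def v_def by metis
qed

text \<open>The sign \<open>S\<close> allows \<open>f\<close> to cross the target \<open>Z\<close> upwards on one event and downwards on another.\<close>

lemma local_continuous_crossing:
  assumes "prob_space M" "L0_local M f"
    and cont: "continuous_map (L0_topology M) (L0_topology M) f"
    and F: "\<And>X. X \<in> borel_measurable M \<Longrightarrow> F X \<in> borel_measurable M"
      "\<And>X. X \<in> borel_measurable M \<Longrightarrow> f (L0_class M X) = L0_class M (F X)"
    and S[measurable]: "S \<in> borel_measurable M" and Z[measurable]: "Z \<in> borel_measurable M"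
    and S1: "\<And>\<omega>. \<bar>S \<omega>\<bar> = (1::real)"
    and A[measurable]: "A \<in> borel_measurable M" and B[measurable]: "B \<in> borel_measurable M"
    and le: "\<And>\<omega>. A \<omega> \<le> B \<omega>"
    and sign: "AE \<omega> in M. S \<omega> * (F A \<omega> - Z \<omega>) \<le> 0" "AE \<omega> in M. S \<omega> * (F B \<omega> - Z \<omega>) \<ge> 0"
  obtains Y where "Y \<in> borel_measurable M" "\<And>\<omega>. A \<omega> \<le> Y \<omega>" "\<And>\<omega>. Y \<omega> \<le> B \<omega>"
    "AE \<omega> in M. F Y \<omega> = Z \<omega>"
proof -
  define G where "G m \<omega> \<longleftrightarrow> S \<omega> * (F m \<omega> - Z \<omega>) \<le> 0" for m \<omega>
  define p where "p n = (bisect G ^^ n) (A, B)" for n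
  define a where "a n = fst (p n)" for n
  define b where "b n = snd (p n)" for n
  have inv: "a n \<in> borel_measurable M \<and> b n \<in> borel_measurable M \<and>
    (AE \<omega> in M. S \<omega> * (F (a n) \<omega> - Z \<omega>) \<le> 0) \<and> (AE \<omega> in M. S \<omega> * (F (b n) \<omega> - Z \<omega>) \<ge> 0)" for n
  proof (induction n)
    case 0
    then show ?case using A B sign by (simp add: a_def b_def p_def)
  next
    case (Suc n)
    then have [measurable]: "a n \<in> borel_measurable M" "b n \<in> borel_measurable M" by auto
    define m where "m = (\<lambda>\<omega>. (a n \<omega> + b n \<omega>) / 2)"
    have m[measurable]: "m \<in> borel_measurable M" unfolding m_def by measurable
    note [measurable] = F(1)[OF m]
    have G[measurable]: "Measurable.pred M (G m)" unfolding G_def by measurable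
    have p: "p (Suc n) = bisect G (a n, b n)" by (simp add: a_def b_def p_def)
    have ab: "a (Suc n) = (\<lambda>\<omega>. if G m \<omega> then m \<omega> else a n \<omega>)"
      "b (Suc n) = (\<lambda>\<omega>. if G m \<omega> then b n \<omega> else m \<omega>)"
      unfolding a_def[of "Suc n"] b_def[of "Suc n"] p m_def by (simp_all add: Let_def)
    have "AE \<omega> in M. S \<omega> * (F (a (Suc n)) \<omega> - Z \<omega>) \<le> 0"
      unfolding ab
      by (rule L0_local_AE_piecewise[OF assms(2) F, where P = "\<lambda>\<omega> v. S \<omega> * (v - Z \<omega>) \<le> 0"])
        (use Suc in \<open>auto simp: G_def\<close>)
    moreover have "AE \<omega> in M. S \<omega> * (F (b (Suc n)) \<omega> - Z \<omega>) \<ge> 0"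
      unfolding ab
      by (rule L0_local_AE_piecewise[OF assms(2) F, where P = "\<lambda>\<omega> v. S \<omega> * (v - Z \<omega>) \<ge> 0"])
        (use Suc in \<open>auto simp: G_def\<close>)
    moreover have "a (Suc n) \<in> borel_measurable M" "b (Suc n) \<in> borel_measurable M"
      unfolding ab by measurable
    ultimately show ?case by blast
  qed
  have "\<exists>Y. \<forall>\<omega>. A \<omega> \<le> Y \<omega> \<and> Y \<omega> \<le> B \<omega> \<and> (\<lambda>n. a n \<omega>) \<longlonglongrightarrow> Y \<omega> \<and> (\<lambda>n. b n \<omega>) \<longlonglongrightarrow> Y \<omega>"
    unfolding a_def b_def p_def by (intro choice allI bisect_limit le)
  then obtain Y where Y: "\<And>\<omega>. A \<omega> \<le> Y \<omega>" "\<And>\<omega>. Y \<omega> \<le> B \<omega>"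
    and lim: "\<And>\<omega>. (\<lambda>n. a n \<omega>) \<longlonglongrightarrow> Y \<omega>" "\<And>\<omega>. (\<lambda>n. b n \<omega>) \<longlonglongrightarrow> Y \<omega>" by blast
  have meas: "a n \<in> borel_measurable M" "b n \<in> borel_measurable M" for n using inv by auto
  have Ym: "Y \<in> borel_measurable M"
    using lim(1) meas(1) by (rule borel_measurable_LIMSEQ_real)
  have "AE \<omega> in M. S \<omega> * (F Y \<omega> - Z \<omega>) \<le> 0"
    by (rule L0_AE_sign_limit[where X = a, OF assms(1) cont F _ _ _ meas(1) Ym]) (use inv lim S1 in auto)
  \<comment> \<open>The upper sign condition is the lower one for \<open>- S\<close>.\<close>
  moreover have "AE \<omega> in M. - S \<omega> * (F Y \<omega> - Z \<omega>) \<le> 0"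
    by (rule L0_AE_sign_limit[where X = b, OF assms(1) cont F _ _ _ meas(2) Ym]) (use inv lim S1 in auto)
  ultimately have "AE \<omega> in M. F Y \<omega> = Z \<omega>"
  proof eventually_elim
    case (elim \<omega>)
    moreover have "S \<omega> \<noteq> 0" using S1[of \<omega>] by auto
    ultimately show ?case by simp
  qed
  with Ym Y show thesis by (rule that)
qed

section \<open>The intermediate value theorem\<close>

theorem theorem1p1:
  fixes M :: "'a measure"
    and f :: "('a \<Rightarrow> real) set \<Rightarrow> ('a \<Rightarrow> real) set"
    and Y\<^sub>1 Y\<^sub>2 :: "('a \<Rightarrow> real) set"
  assumes "prob_space M"
    and "f \<in> L0 M \<rightarrow> L0 M"
    and "L0_local M f"
    and "continuous_map (L0_topology M) (L0_topology M) f"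
    and "Y\<^sub>1 \<in> L0 M" and "Y\<^sub>2 \<in> L0 M"
    and "L0_le M Y\<^sub>1 Y\<^sub>2"
  shows "\<forall>\<xi> \<in> \<lbrace>f Y\<^sub>1 \<sqinter>\<^bsub>L0_order M\<^esub> f Y\<^sub>2 .. f Y\<^sub>1 \<squnion>\<^bsub>L0_order M\<^esub> f Y\<^sub>2\<rbrace>\<^bsub>L0_order M\<^esub>.
    \<exists>\<eta> \<in> \<lbrace>Y\<^sub>1 .. Y\<^sub>2\<rbrace>\<^bsub>L0_order M\<^esub>. f \<eta> = \<xi>"
proof
  fix \<xi> assume \<xi>: "\<xi> \<in> \<lbrace>f Y\<^sub>1 \<sqinter>\<^bsub>L0_order M\<^esub> f Y\<^sub>2 .. f Y\<^sub>1 \<squnion>\<^bsub>L0_order M\<^esub> f Y\<^sub>2\<rbrace>\<^bsub>L0_order M\<^esub>"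
  have "\<exists>V. V \<in> borel_measurable M \<and> f (L0_class M X) = L0_class M V"
    if "X \<in> borel_measurable M" for X
    by (rule L0E[OF funcset_mem[OF assms(2) L0_class_in_L0[OF that]]]) blast
  then obtain F where F: "\<And>X. X \<in> borel_measurable M \<Longrightarrow> F X \<in> borel_measurable M"
    "\<And>X. X \<in> borel_measurable M \<Longrightarrow> f (L0_class M X) = L0_class M (F X)"
    by metis
  obtain A where A[measurable]: "A \<in> borel_measurable M" and YA: "Y\<^sub>1 = L0_class M A"
    using assms(5) by (rule L0E)
  obtain B' where B'[measurable]: "B' \<in> borel_measurable M" and YB': "Y\<^sub>2 = L0_class M B'"
    using assms(6) by (rule L0E)
  \<comment> \<open>A representative of \<open>Y\<^sub>2\<close> that dominates \<open>A\<close> everywhere, so that bisection converges at every \<open>\<omega>\<close>.\<close>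
  define B where "B \<omega> = max (A \<omega>) (B' \<omega>)" for \<omega>
  have B[measurable]: "B \<in> borel_measurable M" unfolding B_def by measurable
  have "AE \<omega> in M. A \<omega> \<le> B' \<omega>" using assms(7) by (simp add: YA YB' L0_le_class)
  then have "AE \<omega> in M. B' \<omega> = B \<omega>" by eventually_elim (simp add: B_def)
  then have YB: "Y\<^sub>2 = L0_class M B" unfolding YB' by (rule L0_class_cong_AE[OF B' B])
  have "\<xi> \<in> L0 M" using \<xi> by (simp add: at_least_at_most_def L0_order_def)
  then obtain Z where Z[measurable]: "Z \<in> borel_measurable M" and xZ: "\<xi> = L0_class M Z"
    by (rule L0E)
  note [measurable] = F(1)[OF A] F(1)[OF B]
  have le: "L0_le M (f Y\<^sub>1 \<sqinter>\<^bsub>L0_order M\<^esub> f Y\<^sub>2) \<xi>" "L0_le M \<xi> (f Y\<^sub>1 \<squnion>\<^bsub>L0_order M\<^esub> f Y\<^sub>2)"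
    using \<xi> unfolding at_least_at_most_def by (simp_all add: L0_order_def)
  have between: "AE \<omega> in M. min (F A \<omega>) (F B \<omega>) \<le> Z \<omega>" "AE \<omega> in M. Z \<omega> \<le> max (F A \<omega>) (F B \<omega>)"
    using le by (simp_all add: YA YB F xZ meet_L0 join_L0 L0_le_class)
  define S :: "'a \<Rightarrow> real" where "S \<omega> = (if F A \<omega> \<le> F B \<omega> then 1 else - 1)" for \<omega>
  have S[measurable]: "S \<in> borel_measurable M" unfolding S_def by measurable
  have sign: "AE \<omega> in M. S \<omega> * (F A \<omega> - Z \<omega>) \<le> 0" "AE \<omega> in M. S \<omega> * (F B \<omega> - Z \<omega>) \<ge> 0"
    using between by (eventually_elim; auto simp: S_def min_def max_def)+
  have S1: "\<bar>S \<omega>\<bar> = 1" and AB: "A \<omega> \<le> B \<omega>" for \<omega> by (simp_all add: S_def B_def)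
  obtain Y where Y: "Y \<in> borel_measurable M" "\<And>\<omega>. A \<omega> \<le> Y \<omega>" "\<And>\<omega>. Y \<omega> \<le> B \<omega>"
    "AE \<omega> in M. F Y \<omega> = Z \<omega>"
    by (rule local_continuous_crossing[OF assms(1,3,4) F S Z S1 A B AB sign]) (assumption | rule that)+
  have "f (L0_class M Y) = \<xi>"
    unfolding xZ F(2)[OF Y(1)] by (rule L0_class_cong_AE[OF F(1)[OF Y(1)] Z Y(4)])
  moreover have "L0_class M Y \<in> \<lbrace>Y\<^sub>1 .. Y\<^sub>2\<rbrace>\<^bsub>L0_order M\<^esub>"
    using Y A B unfolding at_least_at_most_def
    by (simp add: L0_order_def YA YB L0_le_class L0_class_in_L0)
  ultimately show "\<exists>\<eta> \<in> \<lbrace>Y\<^sub>1 .. Y\<^sub>2\<rbrace>\<^bsub>L0_order M\<^esub>. f \<eta> = \<xi>" by blast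
qed

end
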